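(* Let $n\ge 1$ and let $\alpha=(\alpha_1,\dots,\alpha_k)$ be a composition of $n$ (positive integers summing to $n$). Then \[ \sum_{\sigma\in\mathcal{OP}_{n,\alpha}} q^{\mathrm{minimaj}(\sigma)}=\sum_{\sigma\in\mathcal{OP}_{n,\alpha}} q^{\mathrm{inv}(\sigma)}=F_{n,\alpha}(q), \] where \[ F_{n,\alpha}(q):=\prod_{i=1}^k\ \sum_{j=0}^{\alpha_1+\cdots+\alpha_{i-1}}\binom{\alpha_i-1+j}{\alpha_i-1}q^{j}. \]
   Context: An ordered set partition of $[n]=\{1,\dots,n\}$ is a sequence $\sigma=(B_1|\dots|B_k)$ of nonempty pairwise disjoint subsets (blocks) with union $[n]$; its shape is $(|B_1|,\dots,|B_k|)$. $\mathcal{OP}_{n,\alpha}$ denotes the set of ordered set partitions of $[n]$ of shape $\alpha$. An inversion of $\sigma$ is a pair $i<j$ such that $j\in B_\ell$ and $i=\min(B_m)$ for some $\ell<m$; $\mathrm{inv}(\sigma)$ is the number of inversions. For a word $w=w_1\dots w_n$, $\mathrm{maj}(w)=\sum_{i: w_i>w_{i+1}} i$. $S(\sigma)$ is the set of permutations (in one-line notation) obtained by writing the blocks of $\sigma$ in order, with the letters within each block arranged in any order; $\mathrm{minimaj}(\sigma)=\min\{\mathrm{maj}(\pi):\pi\in S(\sigma)\}$. *)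

theory Defs
  imports
    "HOL-Computational_Algebra.Polynomial"
    "HOL-Combinatorics.Multiset_Permutations"
    "HOL-Library.Disjoint_Sets"
begin

definition compositions :: "nat \<Rightarrow> nat list set" where
  "compositions n = {\<alpha>. (\<forall>a\<in>set \<alpha>. 0 < a) \<and> sum_list \<alpha> = n}"

definition ordered_set_partitions :: "nat \<Rightarrow> nat set list set" where
  "ordered_set_partitions n =
     {\<sigma>. {} \<notin> set \<sigma> \<and> disjoint_family_on (\<lambda>i. \<sigma> ! i) {..<length \<sigma>} \<and> \<Union>(set \<sigma>) = {1..n}}"

definition shape :: "nat set list \<Rightarrow> nat list" where
  "shape \<sigma> = map card \<sigma>"

definition OP :: "nat \<Rightarrow> nat list \<Rightarrow> nat set list set" where
  "OP n \<alpha> = {\<sigma> \<in> ordered_set_partitions n. shape \<sigma> = \<alpha>}"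

definition osp_inversions :: "nat set list \<Rightarrow> (nat \<times> nat) set" where
  "osp_inversions \<sigma> =
     {(i, j). i < j \<and> (\<exists>l m. l < m \<and> m < length \<sigma> \<and> j \<in> \<sigma> ! l \<and> i = Min (\<sigma> ! m))}"

definition osp_inv :: "nat set list \<Rightarrow> nat" where
  "osp_inv \<sigma> = card (osp_inversions \<sigma>)"

text \<open>Positions in words are counted from 1, so the letter \<open>w\<^sub>i\<close> is \<^term>\<open>w ! (i - 1)\<close>.\<close>

definition maj :: "nat list \<Rightarrow> nat" where
  "maj w = \<Sum>{i. 1 \<le> i \<and> i < length w \<and> w ! (i - 1) > w ! i}"

definition block_words :: "nat set list \<Rightarrow> nat list set" where
  "block_words \<sigma> =
     {concat ws | ws. list_all2 (\<lambda>w B. w \<in> permutations_of_set B) ws \<sigma>}"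

definition minimaj :: "nat set list \<Rightarrow> nat" where
  "minimaj \<sigma> = Min (maj ` block_words \<sigma>)"

text \<open>The parts of \<open>\<alpha>\<close> are indexed from 0, so \<^term>\<open>sum_list (take i \<alpha>)\<close> is the
  sum of the parts strictly before \<^term>\<open>\<alpha> ! i\<close>; \<^term>\<open>monom c j\<close> stands for \<open>c q\<^sup>j\<close>.\<close>

definition F_poly :: "nat list \<Rightarrow> int poly" where
  "F_poly \<alpha> =
     (\<Prod>i<length \<alpha>. \<Sum>j=0..sum_list (take i \<alpha>).
        monom (int ((\<alpha> ! i - 1 + j) choose (\<alpha> ! i - 1))) j)"

end

theory Submission imports Defs begin

text \<open>
  Remove the last block \<open>A\<close> of an ordered set partition, put \<open>r = min A\<close>, and let \<open>j\<close> be the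
  number of remaining letters exceeding \<open>r\<close>. There are \<open>binom(|A| - 1 + j, |A| - 1)\<close> choices of
  \<open>A\<close> with a given \<open>j\<close>, and \<open>inv\<close> drops by exactly \<open>j\<close>.

  For \<open>minimaj\<close> it is optimal to write \<open>A\<close> increasingly, so only the letter \<open>r\<close> of \<open>A\<close> matters.
  Moving the letters smaller than \<open>r\<close> above all others, keeping their relative order (a cyclic
  rotation of the alphabet), turns \<open>maj (w r)\<close> into \<open>maj w\<close> plus \<open>j\<close> for every word \<open>w\<close> avoiding
  \<open>r\<close>. Hence \<open>minimaj\<close> also drops by \<open>j\<close>, up to a relabelling of the remaining blocks, and both
  generating functions satisfy the recursion of the product.
\<close>

section \<open>Ordered set partitions of a finite ground set and their last block\<close>

text \<open>Deleting a block from a partition of \<open>{1..n}\<close> leaves a ground set that need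
  not be an initial interval, so the induction runs over arbitrary sets of naturals.\<close>

definition osps :: "nat set \<Rightarrow> nat list \<Rightarrow> nat set list set" where
  "osps S \<alpha> = {\<sigma>. {} \<notin> set \<sigma> \<and> disjoint_family_on (\<lambda>i. \<sigma> ! i) {..<length \<sigma>} \<and>
     \<Union>(set \<sigma>) = S \<and> map card \<sigma> = \<alpha>}"

lemma OP_eq_osps: "OP n \<alpha> = osps {1..n} \<alpha>"
  by (auto simp: OP_def ordered_set_partitions_def shape_def osps_def)

lemma disjoint_nth_snoc:
  "disjoint_family_on (\<lambda>i. (\<sigma> @ [A]) ! i) {..<length (\<sigma> @ [A])} \<longleftrightarrow>
     disjoint_family_on (\<lambda>i. \<sigma> ! i) {..<length \<sigma>} \<and> A \<inter> \<Union>(set \<sigma>) = {}"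
proof -
  have "disjoint_family_on (\<lambda>i. (\<sigma> @ [A]) ! i) {..<length (\<sigma> @ [A])} \<longleftrightarrow>
      disjoint_family_on (\<lambda>i. (\<sigma> @ [A]) ! i) (insert (length \<sigma>) {..<length \<sigma>})"
    by (simp add: lessThan_Suc)
  also have "\<dots> \<longleftrightarrow> A \<inter> (\<Union>i<length \<sigma>. (\<sigma> @ [A]) ! i) = {} \<and>
      disjoint_family_on (\<lambda>i. (\<sigma> @ [A]) ! i) {..<length \<sigma>}"
    by (subst disjoint_family_on_insert) auto
  also have "(\<Union>i<length \<sigma>. (\<sigma> @ [A]) ! i) = \<Union>(set \<sigma>)"
    by (auto simp: set_conv_nth nth_append)
  also have "disjoint_family_on (\<lambda>i. (\<sigma> @ [A]) ! i) {..<length \<sigma>} \<longleftrightarrow>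
      disjoint_family_on (\<lambda>i. \<sigma> ! i) {..<length \<sigma>}"
    by (auto simp: disjoint_family_on_def nth_append)
  finally show ?thesis by blast
qed

text \<open>The blocks before \<open>A\<close> avoid \<open>A\<close>, hence their union is exactly
  \<open>S - A\<close>. This is what allows induction on the last block.\<close>

lemma snoc_in_osps_iff:
  "\<sigma> @ [A] \<in> osps S (\<alpha> @ [a]) \<longleftrightarrow> A \<noteq> {} \<and> A \<subseteq> S \<and> card A = a \<and> \<sigma> \<in> osps (S - A) \<alpha>"
  unfolding osps_def mem_Collect_eq disjoint_nth_snoc by auto

lemma osps_Nil: "osps S [] = (if S = {} then {[]} else {})"
  by (auto simp: osps_def disjoint_family_on_def)

lemma finite_osps:
  assumes "finite S"
  shows "finite (osps S \<alpha>)"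
proof (rule finite_subset)
  show "osps S \<alpha> \<subseteq> {\<sigma>. set \<sigma> \<subseteq> Pow S \<and> length \<sigma> = length \<alpha>}"
    by (auto simp: osps_def)
  show "finite {\<sigma>. set \<sigma> \<subseteq> Pow S \<and> length \<sigma> = length \<alpha>}"
    using assms by (intro finite_lists_length_eq) auto
qed

text \<open>Splitting off the last block is a bijection onto pairs \<open>(A, \<sigma>)\<close>;
  \<open>0 < a\<close> guarantees that every \<open>A\<close> of size \<open>a\<close> is nonempty,
  as a block must be.\<close>

lemma sum_osps_snoc:
  assumes "finite S" "0 < a"
  shows "(\<Sum>\<sigma>\<in>osps S (\<alpha> @ [a]). f \<sigma>) =
    (\<Sum>A | A \<subseteq> S \<and> card A = a. \<Sum>\<sigma>\<in>osps (S - A) \<alpha>. f (\<sigma> @ [A]))"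
proof -
  let ?P = "SIGMA A:{A. A \<subseteq> S \<and> card A = a}. osps (S - A) \<alpha>"
  have "\<tau> \<in> (\<lambda>(A, \<sigma>). \<sigma> @ [A]) ` ?P" if \<tau>: "\<tau> \<in> osps S (\<alpha> @ [a])" for \<tau>
  proof -
    from \<tau> have "\<tau> \<noteq> []" by (auto simp: osps_def)
    then obtain \<sigma> A where "\<tau> = \<sigma> @ [A]" by (metis rev_exhaust)
    then show ?thesis using \<tau> by (force simp: snoc_in_osps_iff)
  qed
  moreover have "(\<lambda>(A, \<sigma>). \<sigma> @ [A]) ` ?P \<subseteq> osps S (\<alpha> @ [a])"
    using assms by (auto simp: snoc_in_osps_iff)
  ultimately have "osps S (\<alpha> @ [a]) = (\<lambda>(A, \<sigma>). \<sigma> @ [A]) ` ?P" by blast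
  moreover have "inj_on (\<lambda>(A, \<sigma>). \<sigma> @ [A]) ?P"
    by (auto simp: inj_on_def)
  ultimately have "(\<Sum>\<sigma>\<in>osps S (\<alpha> @ [a]). f \<sigma>) = (\<Sum>(A, \<sigma>)\<in>?P. f (\<sigma> @ [A]))"
    by (simp add: sum.reindex case_prod_unfold)
  also have "\<dots> = (\<Sum>A | A \<subseteq> S \<and> card A = a. \<Sum>\<sigma>\<in>osps (S - A) \<alpha>. f (\<sigma> @ [A]))"
    using assms by (intro sum.Sigma [symmetric]) (auto intro: finite_osps)
  finally show ?thesis .
qed

section \<open>Counting the choices of the last block\<close>

text \<open>Induction adds a new smallest element \<open>b\<close>. Sets avoiding \<open>b\<close>
  keep their exponent, because \<open>b\<close> lies below their minimum. Sets containing
  \<open>b\<close> have minimum \<open>b\<close>, so everything outside them counts, and together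
  they supply one new monomial of top degree. For \<open>a > card S\<close> the truncated bound
  makes the right-hand range empty.\<close>

lemma sum_subsets_monom_greater_Min:
  fixes S :: "nat set"
  assumes "finite S" "0 < a"
  shows "(\<Sum>A | A \<subseteq> S \<and> card A = a. monom (1::int) (card {t \<in> S - A. Min A < t})) =
    (\<Sum>j<Suc (card S) - a. monom (int ((a - 1 + j) choose (a - 1))) j)"
  using assms(1)
proof (induction S rule: finite_linorder_min_induct)
  case empty
  have "{A. A \<subseteq> ({}::nat set) \<and> card A = a} = {}" using assms by auto
  then show ?case using assms by simp
next
  case (insert b S)
  define g where "g S A = monom (1::int) (card {t \<in> S - A. Min A < t})" for S A :: "nat set"
  let ?s = "card S"
  have b: "b \<notin> S" using insert.hyps by auto
  let ?C = "{A. A \<subseteq> S \<and> card A = a}" and ?D = "{A. A \<subseteq> S \<and> card A = a - 1}"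
  have fin: "A \<subseteq> S \<Longrightarrow> finite A" for A using insert.hyps finite_subset by blast
  have split: "{A. A \<subseteq> insert b S \<and> card A = a} = ?C \<union> insert b ` ?D"
  proof (intro equalityI subsetI)
    fix A assume A: "A \<in> {A. A \<subseteq> insert b S \<and> card A = a}"
    show "A \<in> ?C \<union> insert b ` ?D"
    proof (cases "b \<in> A")
      case True
      then have "A = insert b (A - {b})" "A - {b} \<in> ?D" using A by auto
      then show ?thesis by blast
    qed (use A in auto)
  next
    fix A assume "A \<in> ?C \<union> insert b ` ?D"
    then show "A \<in> {A. A \<subseteq> insert b S \<and> card A = a}"
      using b fin assms(2) by (auto simp: card_insert_if)
  qed
  have g_C: "g (insert b S) A = g S A" if "A \<in> ?C" for A
  proof -
    have "A \<noteq> {}" "finite A" using that assms(2) fin by auto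
    then have "Min A \<in> S" using that Min_in by blast
    then have "b < Min A" using insert.hyps by auto
    then have "{t \<in> insert b S - A. Min A < t} = {t \<in> S - A. Min A < t}" by auto
    then show ?thesis by (simp add: g_def)
  qed
  have g_D: "g (insert b S) (insert b A) = monom 1 (Suc ?s - a)" if "A \<in> ?D" for A
  proof -
    have "Min (insert b A) = b"
      using that fin insert.hyps by (intro Min_eqI) (auto intro: less_imp_le)
    then have "{t \<in> insert b S - insert b A. Min (insert b A) < t} = S - A"
      using b insert.hyps by auto
    moreover have "card (S - A) = Suc ?s - a"
      using that fin assms(2) by (simp add: card_Diff_subset)
    ultimately show ?thesis by (simp add: g_def)
  qed
  have "inj_on (insert b) ?D" using b by (auto simp: inj_on_def)
  have "(\<Sum>A | A \<subseteq> insert b S \<and> card A = a. g (insert b S) A) =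
      (\<Sum>A\<in>?C. g (insert b S) A) + (\<Sum>A\<in>insert b ` ?D. g (insert b S) A)"
    unfolding split by (rule sum.union_disjoint) (use b insert.hyps in auto)
  also have "(\<Sum>A\<in>?C. g (insert b S) A) = (\<Sum>A\<in>?C. g S A)"
    using g_C by (rule sum.cong [OF refl])
  also have "(\<Sum>A\<in>insert b ` ?D. g (insert b S) A) = (\<Sum>A\<in>?D. monom 1 (Suc ?s - a))"
    using \<open>inj_on (insert b) ?D\<close> g_D by (simp add: sum.reindex)
  also have "\<dots> = monom (int (?s choose (a - 1))) (Suc ?s - a)"
    using insert.hyps n_subsets [of S "a - 1"]
    by (simp add: of_nat_monom mult_monom)
  finally have step: "(\<Sum>A | A \<subseteq> insert b S \<and> card A = a. g (insert b S) A) =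
      (\<Sum>A\<in>?C. g S A) + monom (int (?s choose (a - 1))) (Suc ?s - a)" .
  have IH: "(\<Sum>A\<in>?C. g S A) = (\<Sum>j<Suc ?s - a. monom (int ((a - 1 + j) choose (a - 1))) j)"
    using insert.IH unfolding g_def .
  show ?case
  proof (cases "a \<le> Suc ?s")
    case True
    \<comment> \<open>The range grows by the single index \<open>j = Suc ?s - a\<close>, and there
      \<open>a - 1 + j = ?s\<close> turns the coefficient into the number of sets containing
      \<open>b\<close>.\<close>
    then have "Suc (card (insert b S)) - a = Suc (Suc ?s - a)" "a - 1 + (Suc ?s - a) = ?s"
      using b insert.hyps assms(2) by auto
    then show ?thesis
      using step unfolding g_def IH [unfolded g_def] by (simp only: sum.lessThan_Suc)
  next
    case False
    \<comment> \<open>Here \<open>insert b S\<close> is still too small to contain a set of size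
      \<open>a\<close>: the extra monomial vanishes and the range stays empty.\<close>
    then have "?s choose (a - 1) = 0" by (intro binomial_eq_0) auto
    then show ?thesis using step IH False b insert.hyps by (simp add: g_def)
  qed
qed

section \<open>The recursion satisfied by the product\<close>

lemma F_poly_snoc:
  "F_poly (\<alpha> @ [a]) =
     F_poly \<alpha> * (\<Sum>j=0..sum_list \<alpha>. monom (int ((a - 1 + j) choose (a - 1))) j)"
  by (simp add: F_poly_def nth_append)

text \<open>The relabelled ground set \<open>T'\<close> accommodates the rotation of the alphabet needed for
  \<open>minimaj\<close>; for \<open>inv\<close> it is \<open>T\<close> itself.\<close>

lemma sum_osps_eq_F_poly:
  fixes stat :: "nat set list \<Rightarrow> nat"
  assumes stat_Nil: "stat [] = 0"
    and stat_snoc: "\<And>T A \<alpha>. \<lbrakk>finite T; finite A; A \<noteq> {}; A \<inter> T = {}\<rbrakk> \<Longrightarrow>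
      \<exists>T'. finite T' \<and> card T' = card T \<and>
        (\<Sum>\<sigma>\<in>osps T \<alpha>. monom (1::int) (stat (\<sigma> @ [A]))) =
        monom 1 (card {t \<in> T. Min A < t}) * (\<Sum>\<sigma>\<in>osps T' \<alpha>. monom 1 (stat \<sigma>))"
    and "finite S" "card S = sum_list \<alpha>" "\<forall>a\<in>set \<alpha>. 0 < a"
  shows "(\<Sum>\<sigma>\<in>osps S \<alpha>. monom (1::int) (stat \<sigma>)) = F_poly \<alpha>"
  using assms(3-5)
proof (induction \<alpha> arbitrary: S rule: rev_induct)
  case Nil
  then show ?case by (simp add: osps_Nil stat_Nil F_poly_def)
next
  case (snoc a \<alpha>)
  have inner: "(\<Sum>\<sigma>\<in>osps (S - A) \<alpha>. monom (1::int) (stat (\<sigma> @ [A]))) =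
      monom 1 (card {t \<in> S - A. Min A < t}) * F_poly \<alpha>" if "A \<subseteq> S" "card A = a" for A
  proof -
    have A: "finite A" "A \<noteq> {}" using that snoc.prems finite_subset by auto
    then obtain T' where "finite T'" "card T' = card (S - A)"
      and T': "(\<Sum>\<sigma>\<in>osps (S - A) \<alpha>. monom (1::int) (stat (\<sigma> @ [A]))) =
        monom 1 (card {t \<in> S - A. Min A < t}) * (\<Sum>\<sigma>\<in>osps T' \<alpha>. monom 1 (stat \<sigma>))"
      using stat_snoc [of "S - A" A \<alpha>] snoc.prems(1) by auto
    moreover have "card (S - A) = sum_list \<alpha>"
      using that A snoc.prems by (simp add: card_Diff_subset)
    \<comment> \<open>The induction hypothesis covers every finite ground set of size
      \<open>sum_list \<alpha>\<close>, so only the cardinality of \<open>T'\<close>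
      matters.\<close>
    ultimately show ?thesis using snoc.IH [of T'] snoc.prems by simp
  qed
  have "(\<Sum>\<sigma>\<in>osps S (\<alpha> @ [a]). monom (1::int) (stat \<sigma>)) =
      (\<Sum>A | A \<subseteq> S \<and> card A = a. monom 1 (card {t \<in> S - A. Min A < t}) * F_poly \<alpha>)"
    using snoc.prems inner by (subst sum_osps_snoc) (auto intro!: sum.cong)
  also have "\<dots> = (\<Sum>j<Suc (card S) - a. monom (int ((a - 1 + j) choose (a - 1))) j) * F_poly \<alpha>"
    using sum_subsets_monom_greater_Min [of S a] snoc.prems
    by (simp only: flip: sum_distrib_right) simp
  \<comment> \<open>Since \<open>card S = sum_list \<alpha> + a\<close>, the exclusive bound becomes
    the inclusive bound \<open>sum_list \<alpha>\<close> of the last factor.\<close>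
  also have "{..<Suc (card S) - a} = {0..sum_list \<alpha>}"
    using snoc.prems by auto
  finally show ?case by (simp add: F_poly_snoc mult.commute)
qed

section \<open>Inversions and the last block\<close>

lemma osp_inversionsI:
  assumes "Min (\<sigma> ! m) < j" "l < m" "m < length \<sigma>" "j \<in> \<sigma> ! l"
  shows "(Min (\<sigma> ! m), j) \<in> osp_inversions \<sigma>"
  using assms by (auto simp: osp_inversions_def)

text \<open>No block follows \<open>A\<close>, so \<open>A\<close> enters a new inversion only
  through its minimum, paired with a larger letter of \<open>T\<close>. Such pairs are new because
  \<open>Min A\<close> is not in \<open>T\<close>.\<close>

lemma osp_inv_snoc:
  assumes \<sigma>: "\<sigma> \<in> osps T \<alpha>" and "finite T" "finite A" "A \<noteq> {}" "A \<inter> T = {}"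
  shows "osp_inv (\<sigma> @ [A]) = osp_inv \<sigma> + card {t \<in> T. Min A < t}"
proof -
  let ?L = "osp_inversions \<sigma>" and ?R = "Pair (Min A) ` {t \<in> T. Min A < t}"
  have T: "T = \<Union>(set \<sigma>)" using \<sigma> by (simp add: osps_def)
  have min_in: "Min (\<sigma> ! m) \<in> T" if "m < length \<sigma>" for m
  proof -
    have "\<sigma> ! m \<in> set \<sigma>" using that by simp
    moreover from this have "\<sigma> ! m \<noteq> {}" "finite (\<sigma> ! m)"
      using \<sigma> T \<open>finite T\<close> by (auto simp: osps_def intro: finite_subset)
    ultimately show ?thesis unfolding T using Min_in by blast
  qed
  have L: "?L \<subseteq> T \<times> T"
  proof clarify
    fix i j assume "(i, j) \<in> ?L"
    then obtain l m where "l < m" "m < length \<sigma>" "j \<in> \<sigma> ! l" "i = Min (\<sigma> ! m)"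
      by (auto simp: osp_inversions_def)
    then show "i \<in> T \<and> j \<in> T" using min_in by (auto simp: T intro!: bexI [of _ "\<sigma> ! l"])
  qed
  have "osp_inversions (\<sigma> @ [A]) = ?L \<union> ?R"
  proof (intro equalityI subsetI; clarify)
    fix i j assume *: "(i, j) \<in> osp_inversions (\<sigma> @ [A])" "(i, j) \<notin> ?R"
    then obtain l m where lm: "i < j" "l < m" "m < Suc (length \<sigma>)"
      "j \<in> (\<sigma> @ [A]) ! l" "i = Min ((\<sigma> @ [A]) ! m)"
      by (auto simp: osp_inversions_def)
    then have "j \<in> T" by (auto simp: T nth_append)
    then have "m \<noteq> length \<sigma>" using * lm by auto
    then show "(i, j) \<in> ?L"
      using lm osp_inversionsI [of \<sigma> m j l] by (simp add: nth_append)
  next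
    fix i j assume "(i, j) \<in> ?L \<union> ?R"
    then show "(i, j) \<in> osp_inversions (\<sigma> @ [A])"
    proof
      assume "(i, j) \<in> ?L"
      then obtain l m where "i < j" "l < m" "m < length \<sigma>" "j \<in> \<sigma> ! l" "i = Min (\<sigma> ! m)"
        by (auto simp: osp_inversions_def)
      then show ?thesis
        using osp_inversionsI [of "\<sigma> @ [A]" m j l] by (simp add: nth_append)
    next
      assume "(i, j) \<in> ?R"
      then obtain l where "l < length \<sigma>" "j \<in> \<sigma> ! l" "i = Min A" "i < j"
        by (auto simp: T in_set_conv_nth)
      then show ?thesis
        using osp_inversionsI [of "\<sigma> @ [A]" "length \<sigma>" j l] by (simp add: nth_append)
    qed
  qed
  moreover have "?L \<inter> ?R = {}"
    using L Min_in [OF \<open>finite A\<close> \<open>A \<noteq> {}\<close>] \<open>A \<inter> T = {}\<close> by auto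
  moreover have "finite ?L" "finite ?R"
    using L \<open>finite T\<close> finite_subset by auto
  ultimately show ?thesis
    by (simp add: osp_inv_def card_Un_disjoint card_image inj_on_def)
qed

section \<open>Major index under appending letters\<close>

lemma maj_Nil [simp]: "maj [] = 0"
  by (simp add: maj_def)

lemma maj_singleton [simp]: "maj [x] = 0"
  by (simp add: maj_def)

lemma maj_snoc:
  assumes "w \<noteq> []"
  shows "maj (w @ [x]) = maj w + (if x < last w then length w else 0)"
proof -
  let ?D = "{i. 1 \<le> i \<and> i < length w \<and> w ! (i - 1) > w ! i}"
  have "{i. 1 \<le> i \<and> i < length (w @ [x]) \<and> (w @ [x]) ! (i - 1) > (w @ [x]) ! i} =
      ?D \<union> (if x < last w then {length w} else {})"
    using assms by (auto simp: nth_append last_conv_nth less_Suc_eq Suc_le_eq)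
  moreover have "finite ?D" by simp
  ultimately show ?thesis
    unfolding maj_def by (simp add: sum.union_disjoint)
qed

lemma maj_append_mono: "maj w \<le> maj (w @ v)"
proof (induction v rule: rev_induct)
  case (snoc x v)
  then show ?case using maj_snoc [of "w @ v" x] by (cases "w @ v = []") auto
qed simp

lemma maj_snoc_minimum_le:
  assumes "r \<in> set v" "\<forall>x\<in>set v. r \<le> x"
  shows "maj (w @ [r]) \<le> maj (w @ v)"
  using assms
proof (induction v rule: rev_induct)
  case (snoc x v)
  show ?case
  proof (cases "r \<in> set v")
    case True
    then have "maj (w @ [r]) \<le> maj (w @ v)" using snoc by simp
    also have "\<dots> \<le> maj ((w @ v) @ [x])" by (rule maj_append_mono)
    finally show ?thesis by simp
  next
    case False
    then have "x = r" using snoc by auto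
    show ?thesis
    proof (cases "v = []")
      case nonempty: False
      then have "last v \<in> set v" by simp
      then have "r < last v" using snoc False by (metis Un_iff le_neq_implies_less set_append)
      then have "maj (w @ v @ [x]) = maj (w @ v) + length (w @ v)"
        using maj_snoc [of "w @ v" x] nonempty \<open>x = r\<close> by simp
      moreover have "maj w + length w \<le> maj (w @ v) + length (w @ v)"
        using maj_append_mono [of w v] by simp
      moreover have "maj (w @ [r]) \<le> maj w + length w"
        by (cases "w = []") (auto simp: maj_snoc)
      ultimately show ?thesis by simp
    qed (use \<open>x = r\<close> in simp)
  qed
qed simp

text \<open>An increasing \<open>v\<close> has no descent beyond the one possibly entering its head;
  this shows that the lower bound is attained.\<close>

lemma maj_append_sorted:
  assumes "sorted v" "v \<noteq> []"
  shows "maj (w @ v) = maj (w @ [hd v])"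
  using assms
proof (induction v rule: rev_induct)
  case (snoc x v)
  then show ?case
    using maj_snoc [of "w @ v" x] by (cases "v = []") (auto simp: sorted_append leD)
qed simp

text \<open>With \<open>y\<close>, \<open>x\<close> two consecutive letters and \<open>[P]\<close> the truth value of \<open>P\<close>, the induction step is
  the identity \<open>[y > x] + [x > r] - [y > r] = [f y > f x]\<close>.\<close>

lemma maj_snoc_rotate:
  fixes r :: nat
  assumes "r \<notin> set w"
    and "\<And>x y. \<lbrakk>x \<in> set w; y \<in> set w\<rbrakk> \<Longrightarrow>
      f x < f y \<longleftrightarrow> (if x < r \<longleftrightarrow> y < r then x < y else y < r)"
  shows "maj (w @ [r]) = length (filter ((<) r) w) + maj (map f w)"
  using assms
proof (induction w rule: rev_induct)
  case (snoc x v)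
  show ?case
  proof (cases "v = []")
    case True
    then show ?thesis using snoc.prems(1) by (auto simp: maj_snoc [of "[x]", simplified])
  next
    case False
    let ?y = "last v"
    have y: "?y \<in> set v" using False by simp
    have IH: "maj v + (if r < ?y then length v else 0) =
        length (filter ((<) r) v) + maj (map f v)"
      using snoc False by (simp add: maj_snoc)
    have f: "f x < f ?y \<longleftrightarrow> (if x < r \<longleftrightarrow> ?y < r then x < ?y else ?y < r)"
      using snoc.prems(2) y by simp
    have "x \<noteq> r" "?y \<noteq> r" using snoc.prems(1) y by auto
    \<comment> \<open>A descent from \<open>x\<close> to \<open>r\<close> has weight
      \<open>length v + 1\<close>. The surplus 1 is the letter \<open>x\<close> counted by
      \<open>filter\<close>; after cancelling \<open>IH\<close>, all other terms carry the factor
      \<open>length v\<close>.\<close>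
    then show ?thesis
      using maj_snoc [of "v @ [x]" r] maj_snoc [of v x] maj_snoc [of "map f v" "f x"] False IH f
      by (auto simp: last_map split: if_splits)
  qed
qed simp

section \<open>Words obtained from the blocks\<close>

lemma block_words_snoc:
  "block_words (\<sigma> @ [A]) = {w @ v | w v. w \<in> block_words \<sigma> \<and> v \<in> permutations_of_set A}"
proof (intro equalityI subsetI)
  fix u assume "u \<in> block_words (\<sigma> @ [A])"
  then show "u \<in> {w @ v | w v. w \<in> block_words \<sigma> \<and> v \<in> permutations_of_set A}"
    by (fastforce simp: block_words_def list_all2_append2 list_all2_Cons2)
next
  fix u assume "u \<in> {w @ v | w v. w \<in> block_words \<sigma> \<and> v \<in> permutations_of_set A}"
  then obtain ws v where "u = concat (ws @ [v])"
    "list_all2 (\<lambda>w B. w \<in> permutations_of_set B) (ws @ [v]) (\<sigma> @ [A])"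
    by (fastforce simp: block_words_def intro: list_all2_appendI)
  then show "u \<in> block_words (\<sigma> @ [A])" unfolding block_words_def by blast
qed

lemma block_words_Nil: "block_words [] = {[]}"
  by (auto simp: block_words_def)

lemma finite_block_words: "finite (block_words \<sigma>)"
proof (induction \<sigma> rule: rev_induct)
  case (snoc A \<sigma>)
  have "block_words (\<sigma> @ [A]) = (\<lambda>(w, v). w @ v) ` (block_words \<sigma> \<times> permutations_of_set A)"
    by (auto simp: block_words_snoc)
  then show ?case using snoc by simp
qed (simp add: block_words_Nil)

text \<open>An infinite block has no arrangement as a list, whence the finiteness condition.
  Nonemptiness makes the \<open>Min\<close> in \<open>minimaj\<close> meaningful.\<close>

lemma block_words_nonempty:
  assumes "\<And>B. B \<in> set \<sigma> \<Longrightarrow> finite B"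
  shows "block_words \<sigma> \<noteq> {}"
  using assms
proof (induction \<sigma> rule: rev_induct)
  case (snoc A \<sigma>)
  then obtain w v where "w \<in> block_words \<sigma>" "v \<in> permutations_of_set A"
    by (metis all_not_in_conv butlast_snoc in_set_butlastD in_set_conv_decomp
        permutations_of_set_empty_iff)
  then show ?case by (auto simp: block_words_snoc)
qed (simp add: block_words_Nil)

lemma block_words_image:
  assumes "inj_on f (\<Union>(set \<sigma>))"
  shows "block_words (map (image f) \<sigma>) = map f ` block_words \<sigma>"
  using assms
proof (induction \<sigma> rule: rev_induct)
  case (snoc A \<sigma>)
  have "permutations_of_set (f ` A) = map f ` permutations_of_set A"
    using snoc.prems by (intro permutations_of_set_image_inj) (auto intro: inj_on_subset)
  moreover have "block_words (map (image f) \<sigma>) = map f ` block_words \<sigma>"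
    using snoc by (auto intro: inj_on_subset)
  ultimately have "block_words (map (image f) (\<sigma> @ [A])) =
      {map f w @ map f v | w v. w \<in> block_words \<sigma> \<and> v \<in> permutations_of_set A}"
    by (simp only: map_append list.map block_words_snoc) blast
  also have "\<dots> = map f ` block_words (\<sigma> @ [A])"
    unfolding block_words_snoc by (auto simp flip: map_append)
  finally show ?case .
qed (simp add: block_words_Nil)

text \<open>Lets the \<open>filter\<close> count of \<open>maj_snoc_rotate\<close> be read as the
  cardinality of a subset of \<open>T\<close>, the same for every block word.\<close>

lemma block_word_letters:
  assumes "w \<in> block_words \<sigma>" "\<sigma> \<in> osps T \<alpha>"
  shows "distinct w \<and> set w = T"
  using assms
proof (induction \<sigma> arbitrary: w T \<alpha> rule: rev_induct)
  case Nil
  then show ?case by (simp add: block_words_Nil osps_def)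
next
  case (snoc A \<sigma>)
  obtain u v where w: "w = u @ v" "u \<in> block_words \<sigma>" "v \<in> permutations_of_set A"
    using snoc.prems(1) by (auto simp: block_words_snoc)
  have "\<alpha> \<noteq> []" using snoc.prems(2) by (auto simp: osps_def)
  then obtain \<beta> b where "\<alpha> = \<beta> @ [b]" by (metis rev_exhaust)
  then have "A \<subseteq> T" "\<sigma> \<in> osps (T - A) \<beta>"
    using snoc.prems(2) by (auto simp: snoc_in_osps_iff)
  then show ?case
    using snoc.IH w by (auto simp: permutations_of_set_def)
qed

section \<open>Minimaj and the last block\<close>

text \<open>Whatever word \<open>w\<close> comes first, the contribution of \<open>A\<close> is
  bounded below by that of its minimum alone, and the increasing arrangement of \<open>A\<close>
  attains this bound. Hence only \<open>w\<close> remains to be minimized over.\<close>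

lemma minimaj_snoc:
  assumes "\<And>B. B \<in> set \<sigma> \<Longrightarrow> finite B" "finite A" "A \<noteq> {}"
  shows "minimaj (\<sigma> @ [A]) = Min ((\<lambda>w. maj (w @ [Min A])) ` block_words \<sigma>)"
proof (rule antisym)
  have *: "finite (block_words \<sigma>)" "block_words \<sigma> \<noteq> {}"
    using assms by (auto simp: finite_block_words block_words_nonempty)
  have **: "finite (block_words (\<sigma> @ [A]))" "block_words (\<sigma> @ [A]) \<noteq> {}"
    by (rule finite_block_words, rule block_words_nonempty) (use assms in auto)
  let ?s = "sorted_list_of_set A"
  have s: "?s \<in> permutations_of_set A" "?s \<noteq> []" "hd ?s = Min A"
    using assms(2,3)
    by (simp_all add: permutations_of_set_def sorted_list_of_set_nonempty insert_absorb)
  show "minimaj (\<sigma> @ [A]) \<le> Min ((\<lambda>w. maj (w @ [Min A])) ` block_words \<sigma>)"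
  proof (rule Min.boundedI)
    fix m assume "m \<in> (\<lambda>w. maj (w @ [Min A])) ` block_words \<sigma>"
    then obtain w where "w \<in> block_words \<sigma>" "m = maj (w @ [Min A])" by blast
    then have "w @ ?s \<in> block_words (\<sigma> @ [A])" "m = maj (w @ ?s)"
      using s maj_append_sorted [of ?s w] by (auto simp: block_words_snoc)
    then show "minimaj (\<sigma> @ [A]) \<le> m"
      unfolding minimaj_def using ** by simp
  qed (use * in auto)
  show "Min ((\<lambda>w. maj (w @ [Min A])) ` block_words \<sigma>) \<le> minimaj (\<sigma> @ [A])"
    unfolding minimaj_def
  proof (rule Min.boundedI)
    fix m assume "m \<in> maj ` block_words (\<sigma> @ [A])"
    then obtain w v where "w \<in> block_words \<sigma>" "set v = A" "m = maj (w @ v)"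
      by (auto simp: block_words_snoc permutations_of_set_def)
    then have "maj (w @ [Min A]) \<le> m" "w \<in> block_words \<sigma>"
      using maj_snoc_minimum_le [of "Min A" v w] assms(2,3) by auto
    then show "Min ((\<lambda>w. maj (w @ [Min A])) ` block_words \<sigma>) \<le> m"
      using * by (meson Min_le finite_imageI image_eqI le_trans)
  qed (use ** in auto)
qed

section \<open>Relabelling the ground set\<close>

lemma map_image_in_osps:
  assumes "\<sigma> \<in> osps T \<alpha>" "inj_on f T"
  shows "map (image f) \<sigma> \<in> osps (f ` T) \<alpha>"
proof -
  have T: "T = \<Union>(set \<sigma>)" using assms by (simp add: osps_def)
  then have sub: "B \<subseteq> T" if "B \<in> set \<sigma>" for B using that by auto
  have "f ` (\<sigma> ! i) \<inter> f ` (\<sigma> ! j) = {}"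
    if "i < length \<sigma>" "j < length \<sigma>" "i \<noteq> j" for i j
  proof -
    have "\<sigma> ! i \<inter> \<sigma> ! j = {}"
      using that assms(1) by (auto simp: osps_def disjoint_family_on_def)
    then show ?thesis
      using that sub inj_on_image_Int [OF assms(2), of "\<sigma> ! i" "\<sigma> ! j"] by simp
  qed
  moreover have "map card (map (image f) \<sigma>) = \<alpha>"
    using assms(1) sub inj_on_subset [OF assms(2)] by (auto simp: osps_def card_image)
  ultimately show ?thesis
    using assms(1) T by (auto simp: osps_def disjoint_family_on_def)
qed

lemma bij_betw_map_image_osps:
  assumes "inj_on f T"
  shows "bij_betw (map (image f)) (osps T \<alpha>) (osps (f ` T) \<alpha>)"
proof (rule bij_betw_byWitness [where f' = "map (image (inv_into T f))"])
  have inv_inj: "inj_on (inv_into T f) (f ` T)" by (rule inj_on_inv_into) simp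
  have inv_T: "inv_into T f ` f ` T = T" using assms by simp
  show "\<forall>\<sigma>\<in>osps T \<alpha>. map (image (inv_into T f)) (map (image f) \<sigma>) = \<sigma>"
    using assms by (auto simp: osps_def o_def intro!: map_idI inv_into_image_cancel)
  show "\<forall>\<sigma>\<in>osps (f ` T) \<alpha>. map (image f) (map (image (inv_into T f)) \<sigma>) = \<sigma>"
    by (auto simp: osps_def o_def intro!: map_idI image_inv_into_cancel [OF refl])
  show "map (image f) ` osps T \<alpha> \<subseteq> osps (f ` T) \<alpha>"
    using assms map_image_in_osps by blast
  show "map (image (inv_into T f)) ` osps (f ` T) \<alpha> \<subseteq> osps T \<alpha>"
    using map_image_in_osps [OF _ inv_inj] inv_T by auto
qed

text \<open>The correction term in \<open>maj_snoc_rotate\<close> depends only on the letters of the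
  word, and every block word of \<open>\<sigma>\<close> has letter set \<open>T\<close>. It is
  therefore a constant that can be pulled out of the minimum. The condition on \<open>f\<close> says
  that \<open>f\<close> keeps the order on either side of \<open>Min A\<close> and lifts the lower
  side above the upper one.\<close>

lemma minimaj_snoc_rotate:
  assumes \<sigma>: "\<sigma> \<in> osps T \<alpha>" and "finite T" "finite A" "A \<noteq> {}" "A \<inter> T = {}"
    and f: "\<And>x y. \<lbrakk>x \<in> T; y \<in> T\<rbrakk> \<Longrightarrow>
      f x < f y \<longleftrightarrow> (if x < Min A \<longleftrightarrow> y < Min A then x < y else y < Min A)"
    and inj: "inj_on f T"
  shows "minimaj (\<sigma> @ [A]) = card {t \<in> T. Min A < t} + minimaj (map (image f) \<sigma>)"
proof -
  let ?c = "card {t \<in> T. Min A < t}"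
  have T: "T = \<Union>(set \<sigma>)" using \<sigma> by (simp add: osps_def)
  have fin: "finite B" if "B \<in> set \<sigma>" for B
    using that T \<open>finite T\<close> by (auto intro: finite_subset)
  have notin: "Min A \<notin> T"
    using Min_in \<open>finite A\<close> \<open>A \<noteq> {}\<close> \<open>A \<inter> T = {}\<close> by blast
  have maj: "maj (w @ [Min A]) = ?c + maj (map f w)" if "w \<in> block_words \<sigma>" for w
  proof -
    have w: "distinct w" "set w = T" using block_word_letters that \<sigma> by auto
    then have "length (filter ((<) (Min A)) w) = ?c"
      by (simp add: distinct_length_filter Int_def conj_commute)
    then show ?thesis using maj_snoc_rotate [of "Min A" w f] w notin f by simp
  qed
  have "minimaj (\<sigma> @ [A]) = Min ((\<lambda>w. maj (map f w) + ?c) ` block_words \<sigma>)"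
    using fin assms maj by (simp add: minimaj_snoc add.commute cong: image_cong)
  also have "\<dots> = Min ((\<lambda>w. maj (map f w)) ` block_words \<sigma>) + ?c"
    by (intro Min_add_commute finite_block_words block_words_nonempty fin)
  also have "\<dots> = minimaj (map (image f) \<sigma>) + ?c"
    using inj T by (simp add: minimaj_def block_words_image image_image)
  finally show ?thesis by simp
qed

section \<open>The last-block recursion for both generating functions\<close>

lemma sum_minimaj_snoc:
  assumes "finite T" "finite A" "A \<noteq> {}" "A \<inter> T = {}"
  shows "\<exists>T'. finite T' \<and> card T' = card T \<and>
    (\<Sum>\<sigma>\<in>osps T \<alpha>. monom (1::int) (minimaj (\<sigma> @ [A]))) =
    monom 1 (card {t \<in> T. Min A < t}) * (\<Sum>\<sigma>\<in>osps T' \<alpha>. monom 1 (minimaj \<sigma>))"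
proof -
  \<comment> \<open>This realizes the rotation inside the naturals: letters below
    \<open>Min A\<close> are shifted past \<open>Max T\<close>. The \<open>Suc\<close> keeps the
    shifted letters strictly above \<open>Max T\<close> even when 0 is a letter.\<close>
  define f where "f x = (if x < Min A then Suc (x + Max T) else x)" for x
  have "x \<le> Max T" if "x \<in> T" for x using that assms(1) by simp
  then have f: "f x < f y \<longleftrightarrow> (if x < Min A \<longleftrightarrow> y < Min A then x < y else y < Min A)"
    if "x \<in> T" "y \<in> T" for x y
    using that by (fastforce simp: f_def)
  have inj: "inj_on f T"
  proof (rule linorder_inj_onI)
    fix x y assume "x < y" "x \<in> T" "y \<in> T"
    \<comment> \<open>For \<open>x < y\<close> the order condition yields \<open>f x < f y\<close>
      on the same side of \<open>Min A\<close> and \<open>f y < f x\<close> on different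
      sides.\<close>
    then show "f x \<noteq> f y" using f [of x y] f [of y x] by (auto split: if_splits)
  qed auto
  have "(\<Sum>\<sigma>\<in>osps T \<alpha>. monom (1::int) (minimaj (\<sigma> @ [A]))) =
      (\<Sum>\<sigma>\<in>osps T \<alpha>. monom 1 (card {t \<in> T. Min A < t}) * monom 1 (minimaj (map (image f) \<sigma>)))"
    using assms f inj
    by (intro sum.cong refl) (simp add: minimaj_snoc_rotate [where f = f] mult_monom)
  also have "\<dots> = monom 1 (card {t \<in> T. Min A < t}) *
      (\<Sum>\<sigma>\<in>osps T \<alpha>. monom 1 (minimaj (map (image f) \<sigma>)))"
    by (simp add: sum_distrib_left)
  also have "(\<Sum>\<sigma>\<in>osps T \<alpha>. monom (1::int) (minimaj (map (image f) \<sigma>))) =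
      (\<Sum>\<sigma>\<in>osps (f ` T) \<alpha>. monom 1 (minimaj \<sigma>))"
    by (rule sum.reindex_bij_betw [OF bij_betw_map_image_osps [OF inj]])
  \<comment> \<open>The witness for \<open>T'\<close> is the rotated alphabet, of the same size by
    injectivity of \<open>f\<close>.\<close>
  finally show ?thesis
    using assms(1) inj by (intro exI [of _ "f ` T"]) (simp add: card_image)
qed

lemma sum_osp_inv_snoc:
  assumes "finite T" "finite A" "A \<noteq> {}" "A \<inter> T = {}"
  shows "\<exists>T'. finite T' \<and> card T' = card T \<and>
    (\<Sum>\<sigma>\<in>osps T \<alpha>. monom (1::int) (osp_inv (\<sigma> @ [A]))) =
    monom 1 (card {t \<in> T. Min A < t}) * (\<Sum>\<sigma>\<in>osps T' \<alpha>. monom 1 (osp_inv \<sigma>))"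
  using assms
  by (intro exI [of _ T]) (simp add: osp_inv_snoc sum_distrib_left mult_monom add.commute cong: sum.cong)

theorem theorem2p6:
  fixes n :: nat and \<alpha> :: "nat list"
  assumes "n \<ge> 1" and "\<alpha> \<in> compositions n"
  shows "(\<Sum>\<sigma>\<in>OP n \<alpha>. monom (1::int) (minimaj \<sigma>)) = (\<Sum>\<sigma>\<in>OP n \<alpha>. monom 1 (osp_inv \<sigma>)) \<and>
         (\<Sum>\<sigma>\<in>OP n \<alpha>. monom 1 (osp_inv \<sigma>)) = F_poly \<alpha>"
proof -
  have \<alpha>: "card {1..n} = sum_list \<alpha>" "\<forall>a\<in>set \<alpha>. 0 < a"
    using assms(2) by (auto simp: compositions_def)
  have "(\<Sum>\<sigma>\<in>OP n \<alpha>. monom (1::int) (minimaj \<sigma>)) = F_poly \<alpha>"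
    unfolding OP_eq_osps
    by (rule sum_osps_eq_F_poly [OF _ sum_minimaj_snoc])
      (use \<alpha> in \<open>simp_all add: minimaj_def block_words_Nil\<close>)
  moreover have "(\<Sum>\<sigma>\<in>OP n \<alpha>. monom (1::int) (osp_inv \<sigma>)) = F_poly \<alpha>"
    unfolding OP_eq_osps
    by (rule sum_osps_eq_F_poly [OF _ sum_osp_inv_snoc])
      (use \<alpha> in \<open>simp_all add: osp_inv_def osp_inversions_def\<close>)
  ultimately show ?thesis by simp
qed

end
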